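(* Let $r\geq 1$ and $k\geq 0$ be integers. For each integer $n\geq 0$, let $N(n,r,k)$ denote the number of binary words of length $n$ which (if $n>0$) begin with the symbol $0$ and which contain exactly $k$ maximal runs of length exactly $r$. Then, as formal power series in $x$, $$\sum_{n=0}^{\infty}N(n,r,k)\,x^n=x^{kr}\left(\frac{1-x}{1-2x+x^r-x^{r+1}}\right)^{k+1}.$$
   Context: A binary word is a finite sequence of symbols from $\{0,1\}$. A maximal run (or simply run) in a binary word is a maximal consecutive subword consisting of identical symbols; equivalently, cutting the word between every pair of consecutive differing symbols yields its runs. The length of a run is its number of symbols. For $n=0$ the only word counted is the empty word, which has no runs (so $N(0,r,0)=1$ and $N(0,r,k)=0$ for $k>0$). *)

theory Defs
  imports Main "HOL-Computational_Algebra.Formal_Power_Series"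
begin

text \<open>
  The list of maximal runs of a word, in order of occurrence: the word is cut between
  every pair of consecutive differing symbols.
\<close>

function runs :: "'a list \<Rightarrow> 'a list list" where
  "runs [] = []"
| "runs (x # xs) = (x # takeWhile (\<lambda>y. y = x) xs) # runs (dropWhile (\<lambda>y. y = x) xs)"
  by pat_completeness auto
termination
  by (relation "measure length") (auto simp: less_Suc_eq_le length_dropWhile_le)

text \<open>
  The following three facts say that \<^term>\<open>runs w\<close> is the decomposition of \<^term>\<open>w\<close> into
  nonempty constant blocks such that neighbouring blocks carry different symbols.
\<close>

lemma concat_runs: "concat (runs w) = w"
  by (induction w rule: runs.induct) auto

lemma runs_constant: "u \<in> set (runs w) \<Longrightarrow> \<exists>x m. u = replicate (Suc m) x"
proof (induction w rule: runs.induct)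
  case 1
  then show ?case by simp
next
  case (2 x xs)
  have "takeWhile (\<lambda>y. y = x) xs = replicate (length (takeWhile (\<lambda>y. y = x) xs)) x"
    by (rule replicate_eqI) (auto dest: set_takeWhileD)
  then have "x # takeWhile (\<lambda>y. y = x) xs = replicate (Suc (length (takeWhile (\<lambda>y. y = x) xs))) x"
    by (metis replicate_Suc)
  with 2 show ?case by (metis runs.simps(2) set_ConsD)
qed

lemma runs_adjacent_differ: "Suc i < length (runs w) \<Longrightarrow> hd (runs w ! i) \<noteq> hd (runs w ! Suc i)"
proof (induction w arbitrary: i rule: runs.induct)
  case 1
  then show ?case by simp
next
  case (2 x xs)
  show ?case
  proof (cases i)
    case 0
    then show ?thesis
      using 2(2) hd_dropWhile[of "\<lambda>y. y = x" xs]
      by (cases "dropWhile (\<lambda>y. y = x) xs") auto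
  next
    case (Suc j)
    then show ?thesis using 2(1)[of j] 2(2) by simp
  qed
qed

definition num_runs :: "nat \<Rightarrow> 'a list \<Rightarrow> nat" where
  "num_runs r w = length (filter (\<lambda>u. length u = r) (runs w))"

definition binary_word :: "nat list \<Rightarrow> bool" where
  "binary_word w \<longleftrightarrow> set w \<subseteq> {0, 1}"

definition N :: "nat \<Rightarrow> nat \<Rightarrow> nat \<Rightarrow> nat" where
  "N n r k = card {w. binary_word w \<and> length w = n \<and> (n > 0 \<longrightarrow> hd w = 0) \<and> num_runs r w = k}"

end

theory Submission
  imports Defs "HOL-Combinatorics.Transposition"
begin

text \<open>
  A nonempty word that begins with \<open>0\<close> splits into its first run, of some length \<open>m\<close>, and a rest
  which is empty or begins with \<open>1\<close>; exchanging the two symbols in the rest gives again a word of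
  the kind counted. So the generating functions \<open>A\<^sub>k\<close> satisfy
  \<open>A\<^sub>k = [k = 0] + (x / (1 - x) - x\<^sup>r) A\<^sub>k + x\<^sup>r A\<^sub>k\<^sub>-\<^sub>1\<close>, and the formula follows by induction on \<open>k\<close>.
\<close>

text \<open>An injective map preserves both equality and inequality of neighbouring symbols, so the
  word is cut at the same positions.\<close>

lemma runs_map_inj:
  assumes "inj f"
  shows "runs (map f w) = map (map f) (runs w)"
proof (induction w rule: runs.induct)
  case (2 x xs)
  have "(\<lambda>y. y = f x) \<circ> f = (\<lambda>y. y = x)"
    using assms by (auto simp: fun_eq_iff dest: injD)
  with 2 show ?case by (simp add: takeWhile_map dropWhile_map)
qed simp

lemma num_runs_map_inj: "inj f \<Longrightarrow> num_runs r (map f w) = num_runs r w"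
  by (simp add: num_runs_def runs_map_inj filter_map o_def)

lemma takeWhile_dropWhile_replicate_append:
  "v = [] \<or> hd v \<noteq> x \<Longrightarrow> takeWhile (\<lambda>y. y = x) (replicate m x @ v) = replicate m x"
  "v = [] \<or> hd v \<noteq> x \<Longrightarrow> dropWhile (\<lambda>y. y = x) (replicate m x @ v) = v"
  by (induction m) (cases v; auto)+

lemma runs_replicate_append:
  assumes "m > 0" "v = [] \<or> hd v \<noteq> x"
  shows "runs (replicate m x @ v) = replicate m x # runs v"
  using assms by (cases m) (simp_all add: takeWhile_dropWhile_replicate_append)

lemma num_runs_replicate_append:
  assumes "m > 0" "v = [] \<or> hd v \<noteq> x"
  shows "num_runs r (replicate m x @ v) = num_runs r v + (if m = r then 1 else 0)"
  using runs_replicate_append[OF assms] by (simp add: num_runs_def)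

lemma finite_binary_words: "finite {w. binary_word w \<and> length w = n \<and> P w}"
proof (rule finite_subset)
  show "finite {w. set w \<subseteq> {0, 1 :: nat} \<and> length w = n}"
    by (rule finite_lists_length_eq) simp
qed (auto simp: binary_word_def)

lemma N_zero: "N 0 r k = (if k = 0 then 1 else 0)"
proof -
  have "{w. binary_word w \<and> length w = 0 \<and> num_runs r w = k} = (if k = 0 then {[]} else {})"
    by (auto simp: binary_word_def num_runs_def)
  then show ?thesis by (simp add: N_def)
qed

text \<open>Exchanging the symbols by a transposition of all naturals gives an involution that is
  injective on the whole type, as \<open>num_runs_map_inj\<close> requires.\<close>

abbreviation flip :: "nat list \<Rightarrow> nat list" where
  "flip \<equiv> map (transpose 0 (Suc 0))"

lemma flip_flip: "flip (flip v) = v"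
  by (simp add: o_def)

lemma binary_word_flip: "binary_word (flip v) \<longleftrightarrow> binary_word v"
  by (auto simp: binary_word_def transpose_def subset_iff split: if_splits)

lemma num_runs_flip: "num_runs r (flip v) = num_runs r v"
  by (intro num_runs_map_inj inj_transpose)

lemma hd_flip: "v \<noteq> [] \<Longrightarrow> hd (flip v) = transpose 0 (Suc 0) (hd v)"
  by (simp add: list.map_sel)

text \<open>The words are sorted by the length \<open>m\<close> of their first run. If
  \<open>m = r\<close>, this run is itself counted and leaves \<open>k - 1\<close> for the rest; the
  case \<open>k = 0\<close> is separate because truncated subtraction would give
  \<open>0 - 1 = 0\<close>.\<close>

lemma N_recurrence:
  assumes "n > 0"
  shows "N n r k = (\<Sum>m = 1..n. if m = r then (if k = 0 then 0 else N (n - m) r (k - 1))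
                                 else N (n - m) r k)"
proof -
  define W where "W = {w. binary_word w \<and> length w = n \<and> (n > 0 \<longrightarrow> hd w = 0) \<and> num_runs r w = k}"
  \<comment> \<open>The possible rests after a first run of length \<open>m\<close>, already
    flipped. Counting by addition makes \<open>V r\<close> empty for \<open>k = 0\<close>.\<close>
  define V where "V m = {v. binary_word v \<and> length v = n - m \<and> (n - m > 0 \<longrightarrow> hd v = 0) \<and>
    num_runs r v + (if m = r then 1 else 0) = k}" for m
  define f where "f = (\<lambda>(m, v). replicate m (0::nat) @ flip v)"
  define g where "g w = (length (takeWhile (\<lambda>y. y = 0) w), flip (dropWhile (\<lambda>y. y = (0::nat)) w))" for w
  \<comment> \<open>Flipping makes a nonempty rest begin with 1, so the zeros put before it form a
    complete run.\<close>
  have V_hd: "flip v = [] \<or> hd (flip v) \<noteq> 0" if "v \<in> V m" for v m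
    using that by (cases "v = []") (auto simp: V_def hd_flip)
  have split: "replicate (length (takeWhile (\<lambda>y. y = 0) w)) 0 @ dropWhile (\<lambda>y. y = 0) w = w"
    for w :: "nat list"
  proof -
    have "replicate (length (takeWhile (\<lambda>y. y = 0) w)) 0 = takeWhile (\<lambda>y. y = 0) w"
      by (rule sym, rule replicate_eqI) (auto dest: set_takeWhileD)
    then show ?thesis by simp
  qed
  have "bij_betw f (SIGMA m:{1..n}. V m) W"
  proof (rule bij_betw_byWitness[where f' = g])
    show "\<forall>p \<in> (SIGMA m:{1..n}. V m). g (f p) = p"
      using V_hd by (auto simp: f_def g_def takeWhile_dropWhile_replicate_append flip_flip simp del: map_map)
    show "\<forall>w \<in> W. f (g w) = w"
      using split by (auto simp: f_def g_def flip_flip simp del: map_map)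
    show "f ` (SIGMA m:{1..n}. V m) \<subseteq> W"
    proof clarify
      fix m v assume m: "m \<in> {1..n}" and v: "v \<in> V m"
      have "num_runs r (replicate m 0 @ flip v) = k"
        using num_runs_replicate_append[OF _ V_hd[OF v], of m r] m v
        by (simp add: V_def num_runs_flip)
      moreover have "binary_word (replicate m 0 @ flip v)"
        using v binary_word_flip[of v] by (auto simp: V_def binary_word_def)
      ultimately show "f (m, v) \<in> W"
        using m v by (cases m) (auto simp: W_def V_def f_def)
    qed
    show "g ` W \<subseteq> (SIGMA m:{1..n}. V m)"
    proof clarify
      fix w m v assume w: "w \<in> W" and gw: "(m, v) = g w"
      define u where "u = dropWhile (\<lambda>y. y = 0) w"
      have m: "m = length (takeWhile (\<lambda>y. y = 0) w)" and v: "v = flip u"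
        using gw by (auto simp: g_def u_def)
      have w_eq: "w = replicate m 0 @ u" using split[of w] by (simp add: m u_def)
      have "w \<noteq> []" "hd w = 0" using w assms by (auto simp: W_def)
      then have m0: "m > 0" by (cases w) (auto simp: m)
      have u_hd: "u = [] \<or> hd u \<noteq> 0"
        unfolding u_def using hd_dropWhile[of "\<lambda>y. y = 0" w] by blast
      have len: "length u = n - m" "m \<le> n" using w w_eq by (auto simp: W_def)
      have bin: "binary_word u" using w w_eq by (auto simp: W_def binary_word_def)
      have "hd v = 0" if "n - m > 0"
      proof -
        have "u \<noteq> []" using that len by auto
        moreover from this have "hd u \<in> {0, 1}"
          using bin hd_in_set[of u] unfolding binary_word_def by blast
        ultimately show ?thesis using u_hd by (auto simp: v hd_flip)
      qed
      then have "v \<in> V m"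
        using num_runs_replicate_append[OF m0 u_hd, of r] w w_eq len bin
        by (auto simp: V_def v W_def binary_word_flip num_runs_flip)
      then show "m \<in> {1..n} \<and> v \<in> V m" using m0 len by simp
    qed
  qed
  then have "card W = card (SIGMA m:{1..n}. V m)" by (rule bij_betw_same_card[symmetric])
  also have "\<dots> = (\<Sum>m = 1..n. card (V m))"
    by (rule card_SigmaI) (auto simp: V_def finite_binary_words)
  also have "\<dots> = (\<Sum>m = 1..n. if m = r then (if k = 0 then 0 else N (n - m) r (k - 1))
                               else N (n - m) r k)"
    by (intro sum.cong) (cases k; auto simp: V_def N_def)+
  finally show ?thesis by (simp add: N_def W_def)
qed

definition N_gf :: "nat \<Rightarrow> nat \<Rightarrow> rat fps" where
  "N_gf r k = Abs_fps (\<lambda>n. of_nat (N n r k))"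

text \<open>\<open>P\<close> enumerates the first runs of length other than \<open>r\<close>. The
  recurrence for positive \<open>n\<close> is a Cauchy product with \<open>P\<close> plus the single
  term \<open>m = r\<close>.\<close>

lemma N_gf_first_run:
  fixes r k :: nat
  assumes "r \<ge> 1"
  defines "P \<equiv> Abs_fps (\<lambda>m. if m = 0 \<or> m = r then 0 else 1 :: rat)"
  shows "N_gf r k = P * N_gf r k + (if k = 0 then 1 else fps_X ^ r * N_gf r (k - 1))"
proof (rule fps_ext)
  fix n
  show "fps_nth (N_gf r k) n =
    fps_nth (P * N_gf r k + (if k = 0 then 1 else fps_X ^ r * N_gf r (k - 1))) n"
  proof (cases "n = 0")
    case True
    then show ?thesis using assms(1) by (simp add: N_gf_def N_zero P_def fps_X_power_mult_nth)
  next
    case False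
    \<comment> \<open>The Cauchy product also has an index 0, whose term vanishes because
      \<open>P\<close> has constant coefficient 0.\<close>
    have "(\<Sum>m = 1..n. if m = r then 0 else of_nat (N (n - m) r k) :: rat) = fps_nth (P * N_gf r k) n"
      unfolding fps_mult_nth
      by (rule sum.mono_neutral_cong_left) (auto simp: P_def N_gf_def)
    moreover have "(\<Sum>m = 1..n. if m = r then (if k = 0 then 0 else of_nat (N (n - m) r (k - 1))) else 0 :: rat)
        = fps_nth (if k = 0 then 1 else fps_X ^ r * N_gf r (k - 1)) n"
      using False assms(1) by (auto simp: N_gf_def fps_X_power_mult_nth sum.delta)
    moreover have "(of_nat (N n r k) :: rat) =
        (\<Sum>m = 1..n. (if m = r then 0 else of_nat (N (n - m) r k)) +
          (if m = r then (if k = 0 then 0 else of_nat (N (n - m) r (k - 1))) else 0))"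
      using False by (simp add: N_recurrence[of n r k] of_nat_sum) (intro sum.cong; simp)
    ultimately show ?thesis by (simp add: sum.distrib N_gf_def)
  qed
qed

text \<open>The factor \<open>1 - fps_X\<close> clears the geometric series in \<open>P\<close>, and
  \<open>(1 - fps_X) * (1 - P)\<close> is the denominator of the theorem.\<close>

lemma N_gf_linear:
  assumes "r \<ge> 1"
  shows "(1 - 2 * fps_X + fps_X ^ r - fps_X ^ (r + 1)) * N_gf r k =
    (1 - fps_X) * (if k = 0 then 1 else fps_X ^ r * N_gf r (k - 1))"
proof -
  define P where "P = Abs_fps (\<lambda>m. if m = 0 \<or> m = r then 0 else 1 :: rat)"
  \<comment> \<open>Since \<open>r\<close> is positive, 0 and \<open>r\<close> are distinct
    exponents, each removed once from the geometric series.\<close>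
  have P_eq: "P = Abs_fps (\<lambda>_. 1) - (1 + fps_X ^ r)"
    using assms by (intro fps_ext) (auto simp: P_def fps_X_power_nth)
  have geometric: "(1 - fps_X) * Abs_fps (\<lambda>_. 1 :: rat) = 1"
    by (rule fps_ext) (auto simp: algebra_simps)
  have P: "(1 - fps_X) * P = fps_X - fps_X ^ r + fps_X ^ (r + 1)"
    unfolding P_eq right_diff_distrib geometric by (simp add: algebra_simps)
  let ?C = "if k = 0 then 1 else fps_X ^ r * N_gf r (k - 1)"
  have "(1 - fps_X) * N_gf r k = (1 - fps_X) * (P * N_gf r k + ?C)"
    using N_gf_first_run[OF assms, of k] by (simp flip: P_def)
  also have "\<dots> = ((1 - fps_X) * P) * N_gf r k + (1 - fps_X) * ?C"
    by (simp only: algebra_simps)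
  finally show ?thesis unfolding P by (simp add: algebra_simps)
qed

theorem mainTheorem1:
  fixes r k :: nat
  assumes "r \<ge> 1"
  shows "Abs_fps (\<lambda>n. of_nat (N n r k) :: rat) =
    fps_X ^ (k * r) * ((1 - fps_X) / (1 - 2 * fps_X + fps_X ^ r - fps_X ^ (r + 1))) ^ (k + 1)"
proof -
  define D :: "rat fps" where "D = 1 - 2 * fps_X + fps_X ^ r - fps_X ^ (r + 1)"
  \<comment> \<open>A nonzero constant coefficient makes \<open>D\<close> a unit, so division by
    \<open>D\<close> is multiplication by its inverse.\<close>
  have "fps_nth D 0 = 1" using assms by (simp add: D_def fps_X_power_nth)
  then have D: "fps_nth D 0 \<noteq> 0" by simp
  \<comment> \<open>Each further run of length \<open>r\<close> thus contributes one factor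
    \<open>fps_X ^ r * (1 - fps_X) / D\<close>.\<close>
  have step: "N_gf r k = (1 - fps_X) / D * (if k = 0 then 1 else fps_X ^ r * N_gf r (k - 1))" for k
  proof -
    have "N_gf r k = inverse D * (D * N_gf r k)"
      using inverse_mult_eq_1[OF D] by (simp flip: mult.assoc)
    also have "D * N_gf r k = (1 - fps_X) * (if k = 0 then 1 else fps_X ^ r * N_gf r (k - 1))"
      unfolding D_def by (rule N_gf_linear[OF assms])
    finally show ?thesis by (simp add: fps_divide_unit[OF D] ac_simps)
  qed
  have "N_gf r k = fps_X ^ (k * r) * ((1 - fps_X) / D) ^ (k + 1)"
  proof (induction k)
    case 0
    then show ?case using step[of 0] by simp
  next
    case (Suc k)
    then show ?case using step[of "Suc k"] by (simp add: power_add ac_simps)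
  qed
  then show ?thesis by (simp add: N_gf_def D_def)
qed

end
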